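(* There exist a non-empty set $C \subseteq \mathbb{D}^2$ and an elementary Fuchsian group $\Gamma$ acting on $\mathbb{D}^2$ such that $$\overline{\dim}_{\mathrm{B}}\, L(\Gamma) = \overline{\dim}_{\mathrm{B}}\, C = \delta(\Gamma) = 0$$ but $$\underline{\dim}_{\mathrm{B}}\, \Gamma(C) = \overline{\dim}_{\mathrm{B}}\, \Gamma(C) = 1,$$ where $\Gamma(C) = \bigcup_{g \in \Gamma} g(C)$.
   Context: $\mathbb{D}^2 = \{z \in \mathbb{R}^2 : |z|<1\}$ is the Poincaré disc with the hyperbolic metric $d$ given by the length element $|ds| = \frac{2|dz|}{1-|z|^2}$. $\mathrm{con}^+(\mathbb{D}^2)$ is the group of orientation preserving isometries of $(\mathbb{D}^2,d)$. A Fuchsian group is a subgroup $\Gamma \leq \mathrm{con}^+(\mathbb{D}^2)$ which is a discrete subset of $\mathrm{con}^+(\mathbb{D}^2)$. The limit set of $\Gamma$ is $L(\Gamma) = \overline{\Gamma(0)} \setminus \Gamma(0)$, where $\Gamma(0)=\{g(0): g \in \Gamma\}$ and the closure is the Euclidean closure. $\Gamma$ is non-elementary if $L(\Gamma)$ contains at least 3 points, and elementary otherwise. The Poincaré exponent is $\delta(\Gamma) = \inf\{s \geq 0 : P_\Gamma(s)<\infty\}$, where $$P_\Gamma(s) = \sum_{g \in \Gamma} \exp(-s\, d(0,g(0))) = \sum_{g\in\Gamma}\left(\frac{1-|g(0)|}{1+|g(0)|}\right)^s .$$ For a bounded set $E \subseteq \mathbb{R}^2$ and a scale $\rho>0$,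 $N_\rho(E)$ is the smallest number of sets of (Euclidean) diameter $\rho$ (equivalently, at most $\rho$) required to cover $E$. The upper and lower box dimensions are $\overline{\dim}_{\mathrm{B}} E = \limsup_{\rho \to 0} \frac{\log N_\rho(E)}{-\log \rho}$ and $\underline{\dim}_{\mathrm{B}} E = \liminf_{\rho \to 0} \frac{\log N_\rho(E)}{-\log \rho}$. All dimensions are computed with respect to the Euclidean metric on $\mathbb{R}^2$. If $L(\Gamma)$ is empty (i.e. $\Gamma$ is finite), its upper box dimension is taken to be $0$. *)

theory Defs
  imports "HOL-Analysis.Analysis" "HOL-Algebra.Bij"
begin

section \<open>The hyperbolic metric on the Poincare disc\<close>

text \<open>The plane is identified with \<^typ>\<open>complex\<close>, whose \<^const>\<open>dist\<close> is the Euclidean metric.\<close>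

abbreviation poincare_disc :: "complex set"
  where "poincare_disc \<equiv> ball 0 1"

text \<open>The infimum is over continuously differentiable curves. Piecewise continuously
  differentiable ones in the sense of \<^const>\<open>valid_path\<close> would not do: their derivative may be
  unbounded near a break point, and a curve of infinite length would get the value \<open>0\<close> that
  \<^const>\<open>integral\<close> has for a non-integrable function. Curves with bounded corners can be smoothed
  without changing the infimum.\<close>

definition hyp_length :: "(real \<Rightarrow> complex) \<Rightarrow> real"
  where "hyp_length \<gamma> =
    integral {0..1} (\<lambda>t. 2 * norm (vector_derivative \<gamma> (at t)) / (1 - (norm (\<gamma> t))\<^sup>2))"

definition hyp_dist :: "complex \<Rightarrow> complex \<Rightarrow> real"
  where "hyp_dist z w =
    (INF \<gamma> \<in> {\<gamma>. \<gamma> C1_differentiable_on {0..1} \<and> path_image \<gamma> \<subseteq> poincare_disc \<and>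
                  pathstart \<gamma> = z \<and> pathfinish \<gamma> = w}. hyp_length \<gamma>)"

section \<open>Orientation preserving isometries and Fuchsian groups\<close>

text \<open>A map of the disc is represented by its extensional representative, as in \<^const>\<open>Bij\<close>:
  it is \<^const>\<open>undefined\<close> off the disc. Distinct representatives are therefore distinct
  isometries, which matters for sums indexed by a group.

  A map preserves orientation at a point if its real derivative there has positive determinant.
  For a real-linear map \<open>f'\<close> of the plane with \<open>f' 1 = a + b * \<i>\<close> and \<open>f' \<i> = c + d * \<i>\<close> this
  determinant is \<open>a * d - b * c = Im (cnj (f' 1) * f' \<i>)\<close>.\<close>

definition orientation_preserving_at :: "(complex \<Rightarrow> complex) \<Rightarrow> complex \<Rightarrow> bool"
  where "orientation_preserving_at g z \<longleftrightarrow>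
    (\<exists>g'. (g has_derivative g') (at z) \<and> Im (cnj (g' 1) * g' \<i>) > 0)"

definition con_plus :: "(complex \<Rightarrow> complex) set"
  where "con_plus = {g \<in> Bij poincare_disc.
    (\<forall>z\<in>poincare_disc. \<forall>w\<in>poincare_disc. hyp_dist (g z) (g w) = hyp_dist z w) \<and>
    (\<forall>z\<in>poincare_disc. orientation_preserving_at g z)}"

text \<open>The compact-open topology. On this group it is the topology of locally uniform
  convergence and also the usual Lie group topology.\<close>

definition con_plus_topology :: "(complex \<Rightarrow> complex) topology"
  where "con_plus_topology = topology_generated_by
    {{g \<in> con_plus. g ` K \<subseteq> U} | K U. compact K \<and> K \<subseteq> poincare_disc \<and> open U}"

text \<open>The group operation of \<^term>\<open>BijGroup poincare_disc\<close> is composition of maps of the disc.\<close>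

definition fuchsian_group :: "(complex \<Rightarrow> complex) set \<Rightarrow> bool"
  where "fuchsian_group \<Gamma> \<longleftrightarrow>
    \<Gamma> \<subseteq> con_plus \<and> subgroup \<Gamma> (BijGroup poincare_disc) \<and>
    subtopology con_plus_topology \<Gamma> = discrete_topology \<Gamma>"

definition group_orbit :: "(complex \<Rightarrow> complex) set \<Rightarrow> complex set \<Rightarrow> complex set"
  where "group_orbit \<Gamma> C = (\<Union>g\<in>\<Gamma>. g ` C)"

definition limit_set :: "(complex \<Rightarrow> complex) set \<Rightarrow> complex set"
  where "limit_set \<Gamma> = closure (group_orbit \<Gamma> {0}) - group_orbit \<Gamma> {0}"

definition non_elementary :: "(complex \<Rightarrow> complex) set \<Rightarrow> bool"
  where "non_elementary \<Gamma> \<longleftrightarrow> (\<exists>A \<subseteq> limit_set \<Gamma>. card A = 3)"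

abbreviation elementary :: "(complex \<Rightarrow> complex) set \<Rightarrow> bool"
  where "elementary \<Gamma> \<equiv> \<not> non_elementary \<Gamma>"

section \<open>The Poincare exponent\<close>

text \<open>Values in \<^typ>\<open>ennreal\<close> and \<^typ>\<open>ereal\<close> make the sum of a divergent series and the
  infimum of the empty set infinite.\<close>

definition poincare_series :: "(complex \<Rightarrow> complex) set \<Rightarrow> real \<Rightarrow> ennreal"
  where "poincare_series \<Gamma> s = (\<Sum>\<^sub>\<infinity>g\<in>\<Gamma>. ennreal (exp (- s * hyp_dist 0 (g 0))))"

definition poincare_exponent :: "(complex \<Rightarrow> complex) set \<Rightarrow> ereal"
  where "poincare_exponent \<Gamma> = (INF s \<in> {s. s \<ge> 0 \<and> poincare_series \<Gamma> s < \<infinity>}. ereal s)"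

section \<open>Box dimensions\<close>

text \<open>The following notions are meant for bounded sets \<open>E\<close>, which have finite covers of this kind
  for every \<open>\<rho> > 0\<close>. The explicit boundedness of the covering sets is needed because
  \<^const>\<open>diameter\<close> is unspecified on unbounded sets.\<close>

definition covering_number :: "real \<Rightarrow> complex set \<Rightarrow> nat"
  where "covering_number \<rho> E =
    (LEAST n. \<exists>\<U>. finite \<U> \<and> card \<U> = n \<and> (\<forall>U\<in>\<U>. bounded U \<and> diameter U \<le> \<rho>) \<and> E \<subseteq> \<Union>\<U>)"

text \<open>The empty set has covering number \<open>0\<close>; since \<open>ln 0 = 0\<close>, both of its box dimensions
  are \<open>0\<close>.\<close>

definition upper_box_dim :: "complex set \<Rightarrow> ereal"
  where "upper_box_dim E =
    Limsup (at_right 0) (\<lambda>\<rho>. ereal (ln (real (covering_number \<rho> E)) / - ln \<rho>))"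

definition lower_box_dim :: "complex set \<Rightarrow> ereal"
  where "lower_box_dim E =
    Liminf (at_right 0) (\<lambda>\<rho>. ereal (ln (real (covering_number \<rho> E)) / - ln \<rho>))"

end

theory Submission
  imports Defs "HOL-Real_Asymp.Real_Asymp"
begin

text \<open>
  A cyclic hyperbolic group already shows the phenomenon, because orbits of a set near a fixed
  point at infinity can spread out in the middle of the disc. Let \<open>T\<^sub>u\<close> be the hyperbolic
  translation along the real diameter with \<open>T\<^sub>u (tanh v) = tanh (u + v)\<close>, and let \<open>\<Gamma>\<close> consist of
  the \<open>T\<^sub>n\<close> with \<open>n\<close> an integer. The orbit of \<open>0\<close> is the set of the points \<open>tanh n\<close>, which
  accumulates only at \<open>\<plusminus>1\<close>, so \<open>\<Gamma>\<close> is elementary and its limit set is at most a pair of points. Since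
  the hyperbolic distance from \<open>0\<close> to \<open>tanh n\<close> is at least \<open>2 \<bar>n\<bar>\<close>, the Poincare series is dominated by a
  convergent geometric series for every \<open>s > 0\<close>, and the exponent is \<open>0\<close>.

  For \<open>C\<close>, enumerate the rationals as \<open>q\<^sub>0, q\<^sub>1, \<dots>\<close> and push the fractional part of \<open>q\<^sub>k\<close> out by
  \<open>k\<close> translations: \<open>C\<close> consists of the points \<open>tanh (k + frac q\<^sub>k)\<close>. These converge
  exponentially fast to \<open>1\<close>, so about \<open>ln (1/\<rho>)\<close> sets of diameter \<open>\<rho>\<close> cover \<open>C\<close> and its box
  dimension is \<open>0\<close> (\<open>upper_box_dim_exponential_sequence\<close>). The group undoes the push, and
  \<open>\<Gamma>(C)\<close> is the image of all rationals under \<open>tanh\<close> (\<open>translates_escaping_points\<close>). This set is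
  dense in \<open>[-1,1]\<close>, and box dimensions do not distinguish a set from its closure, so both are
  \<open>1\<close> (\<open>box_dim_dense_in_interval\<close>).

  That the \<open>T\<^sub>u\<close> are isometries follows from the invariance of the length of every single curve
  (\<open>translated_curve\<close>); the lower bound on the distance comes from projecting a curve to the real
  diameter, which does not increase its length (\<open>hyp_length_lower_bound\<close>).
\<close>

section \<open>Translations along the real diameter\<close>

text \<open>For \<open>u \<in> \<real>\<close> this is the Moebius transformation with fixed points \<open>\<plusminus>1\<close> that moves \<open>0\<close> to
  \<open>tanh u\<close>. The form with \<open>cosh\<close> and \<open>sinh\<close> has determinant \<open>1\<close>, and composition amounts to
  the addition theorems.\<close>

text \<open>The Moebius transformation with fixed points \<open>\<plusminus>1\<close> that moves \<open>0\<close> to \<open>tanh u\<close>. Its matrix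
  with entries \<open>cosh u\<close> and \<open>sinh u\<close> has determinant \<open>1\<close>, and composition amounts to the
  addition theorems.\<close>

definition translation :: "real \<Rightarrow> complex \<Rightarrow> complex"
  where "translation u z =
    (of_real (cosh u) * z + of_real (sinh u)) / (of_real (sinh u) * z + of_real (cosh u))"

lemma translation_denominator_nonzero:
  assumes "norm z < 1"
  shows "of_real (sinh u) * z + of_real (cosh u) \<noteq> (0::complex)"
proof
  assume "of_real (sinh u) * z + of_real (cosh u) = (0::complex)"
  then have "of_real (sinh u) * z = - complex_of_real (cosh u)"
    by (simp add: eq_neg_iff_add_eq_0)
  then have "norm (of_real (sinh u) * z) = cosh u"
    by (metis abs_of_nonneg cosh_real_nonneg norm_minus_cancel norm_of_real)
  then have eq: "\<bar>sinh u\<bar> * norm z = cosh u"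
    by (simp add: norm_mult)
  have "\<bar>sinh u\<bar> * norm z \<le> \<bar>sinh u\<bar> * 1"
    using assms by (intro mult_left_mono) auto
  moreover have "\<bar>sinh u\<bar> < cosh u"
    using sinh_less_cosh_real[of u] sinh_less_cosh_real[of "-u"] by (simp add: abs_if)
  ultimately show False using eq by simp
qed

text \<open>The factor on the right is the modulus of the derivative
  (see \<open>translation_field_derivative\<close> below), so this identity is the invariance of the
  hyperbolic length element; positivity of the right-hand side shows that the disc is preserved.\<close>

lemma one_minus_norm_translation:
  assumes "norm z < 1"
  shows "1 - (norm (translation u z))\<^sup>2 =
    (1 - (norm z)\<^sup>2) / (norm (of_real (sinh u) * z + of_real (cosh u)))\<^sup>2"
proof -
  let ?n = "of_real (cosh u) * z + complex_of_real (sinh u)"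
  let ?d = "of_real (sinh u) * z + complex_of_real (cosh u)"
  have d: "(norm ?d)\<^sup>2 \<noteq> 0"
    using translation_denominator_nonzero[OF assms] by simp
  have "(norm ?d)\<^sup>2 - (norm ?n)\<^sup>2 = ((cosh u)\<^sup>2 - (sinh u)\<^sup>2) * (1 - (norm z)\<^sup>2)"
    by (simp add: cmod_power2) algebra
  also have "\<dots> = 1 - (norm z)\<^sup>2"
    by (simp add: cosh_square_eq)
  finally have "(norm ?d)\<^sup>2 - (norm ?n)\<^sup>2 = 1 - (norm z)\<^sup>2" .
  moreover have "1 - (norm (translation u z))\<^sup>2 = ((norm ?d)\<^sup>2 - (norm ?n)\<^sup>2) / (norm ?d)\<^sup>2"
    using d by (simp add: translation_def norm_divide power_divide diff_divide_distrib)
  ultimately show ?thesis by simp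
qed

lemma norm_translation_less_1:
  assumes "norm z < 1"
  shows "norm (translation u z) < 1"
proof -
  have "0 < (1 - (norm z)\<^sup>2) / (norm (of_real (sinh u) * z + complex_of_real (cosh u)))\<^sup>2"
    using assms translation_denominator_nonzero[OF assms] by (simp add: power_less_one_iff)
  then have "(norm (translation u z))\<^sup>2 < 1"
    using one_minus_norm_translation[OF assms, of u] by linarith
  then show ?thesis by (simp add: power_less_one_iff)
qed

lemma translation_add:
  assumes "norm z < 1"
  shows "translation u (translation v z) = translation (u + v) z"
proof -
  let ?d = "of_real (sinh v) * z + complex_of_real (cosh v)"
  let ?e = "of_real (sinh (u + v)) * z + complex_of_real (cosh (u + v))"
  let ?f = "of_real (cosh (u + v)) * z + complex_of_real (sinh (u + v))"
  have d: "?d \<noteq> 0" using translation_denominator_nonzero[OF assms] .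
  have 1: "of_real (sinh u) * translation v z + of_real (cosh u) = ?e / ?d"
    using d by (simp add: translation_def sinh_add cosh_add field_simps)
  have 2: "of_real (cosh u) * translation v z + of_real (sinh u) = ?f / ?d"
    using d by (simp add: translation_def sinh_add cosh_add field_simps)
  show ?thesis
    unfolding translation_def[of u] 1 2 using d by (simp add: translation_def)
qed

lemma translation_0 [simp]: "translation 0 z = z"
  by (simp add: translation_def)

lemma translation_tanh: "translation u (of_real (tanh v)) = of_real (tanh (u + v))"
proof -
  have "cosh u * tanh v + sinh u = sinh (u + v) / cosh v"
    by (simp add: tanh_def sinh_add cosh_add field_simps)
  moreover have "sinh u * tanh v + cosh u = cosh (u + v) / cosh v"
    by (simp add: tanh_def sinh_add cosh_add field_simps)
  ultimately have "(cosh u * tanh v + sinh u) / (sinh u * tanh v + cosh u) = tanh (u + v)"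
    by (simp add: tanh_def)
  then show ?thesis
    by (simp add: translation_def flip: of_real_mult of_real_add of_real_divide)
qed

lemma translation_field_derivative:
  assumes "norm z < 1"
  shows "(translation u has_field_derivative
    1 / (of_real (sinh u) * z + of_real (cosh u))\<^sup>2) (at z)"
proof -
  let ?d = "of_real (sinh u) * z + complex_of_real (cosh u)"
  have d: "?d \<noteq> 0" using translation_denominator_nonzero[OF assms] .
  have "(of_real (cosh u) * ?d - (of_real (cosh u) * z + of_real (sinh u)) * of_real (sinh u))
      = complex_of_real ((cosh u)\<^sup>2 - (sinh u)\<^sup>2)"
    by (simp add: algebra_simps power2_eq_square)
  also have "\<dots> = 1" by (simp add: cosh_square_eq)
  finally have eq: "of_real (cosh u) * ?d - (of_real (cosh u) * z + of_real (sinh u)) * of_real (sinh u)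
      = (1::complex)" .
  show ?thesis
    unfolding translation_def[abs_def]
    by (rule derivative_eq_intros refl d)+
      (unfold mult_1_left mult_1_right mult_zero_left mult_zero_right add_0_left add_0_right eq,
        simp add: power2_eq_square)
qed

section \<open>Hyperbolic length and translations as isometries\<close>

definition disc_curves :: "complex \<Rightarrow> complex \<Rightarrow> (real \<Rightarrow> complex) set"
  where "disc_curves z w = {\<gamma>. \<gamma> C1_differentiable_on {0..1} \<and> path_image \<gamma> \<subseteq> poincare_disc \<and>
    pathstart \<gamma> = z \<and> pathfinish \<gamma> = w}"

lemma hyp_dist_eq_INF: "hyp_dist z w = (INF \<gamma>\<in>disc_curves z w. hyp_length \<gamma>)"
  by (simp add: hyp_dist_def disc_curves_def)

lemma norm_disc_curve_less_1:
  assumes "\<gamma> \<in> disc_curves z w" "t \<in> {0..1}"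
  shows "norm (\<gamma> t) < 1"
proof -
  have "\<gamma> t \<in> poincare_disc"
    using assms unfolding disc_curves_def path_image_def by blast
  then show ?thesis by simp
qed

lemma disc_curves_nonempty:
  assumes "z \<in> poincare_disc" "w \<in> poincare_disc"
  shows "disc_curves z w \<noteq> {}"
proof -
  have "linepath z w C1_differentiable_on {0..1}"
    unfolding C1_differentiable_on_def
    by (intro exI[of _ "\<lambda>_. w - z"])
      (auto intro: has_vector_derivative_linepath_within)
  moreover have "path_image (linepath z w) \<subseteq> poincare_disc"
    using assms by (simp add: closed_segment_subset)
  ultimately have "linepath z w \<in> disc_curves z w"
    by (simp add: disc_curves_def)
  then show ?thesis by blast
qed

text \<open>The two integrands agree at every parameter: the chain rule multiplies the speed by the
  modulus of the derivative, and \<open>one_minus_norm_translation\<close> multiplies the denominator by the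
  same factor.\<close>

lemma translated_curve:
  assumes "\<gamma> \<in> disc_curves z w"
  shows "translation u \<circ> \<gamma> \<in> disc_curves (translation u z) (translation u w)"
    and "hyp_length (translation u \<circ> \<gamma>) = hyp_length \<gamma>"
proof -
  let ?d = "\<lambda>t. of_real (sinh u) * \<gamma> t + complex_of_real (cosh u)"
  from assms obtain D where D: "\<And>t. t \<in> {0..1} \<Longrightarrow> (\<gamma> has_vector_derivative D t) (at t)"
    and cont: "continuous_on {0..1} D"
    unfolding disc_curves_def C1_differentiable_on_def by blast
  have d: "?d t \<noteq> 0" if "t \<in> {0..1}" for t
    using translation_denominator_nonzero norm_disc_curve_less_1[OF assms that] by blast
  have D': "(translation u \<circ> \<gamma> has_vector_derivative D t * (1 / (?d t)\<^sup>2)) (at t)"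
    if "t \<in> {0..1}" for t
    by (rule field_vector_diff_chain_at[OF D[OF that] translation_field_derivative])
      (rule norm_disc_curve_less_1[OF assms that])
  have "continuous_on {0..1} \<gamma>"
    by (meson D continuous_at_imp_continuous_on has_vector_derivative_continuous)
  then have "continuous_on {0..1} (\<lambda>t. D t * (1 / (?d t)\<^sup>2))"
    using d by (intro continuous_intros cont) auto
  then have "(translation u \<circ> \<gamma>) C1_differentiable_on {0..1}"
    unfolding C1_differentiable_on_def
    by (intro exI[of _ "\<lambda>t. D t * (1 / (?d t)\<^sup>2)"] conjI ballI D')
  moreover have "path_image (translation u \<circ> \<gamma>) \<subseteq> poincare_disc"
    using norm_disc_curve_less_1[OF assms] norm_translation_less_1
    by (auto simp: path_image_def)
  ultimately show "translation u \<circ> \<gamma> \<in> disc_curves (translation u z) (translation u w)"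
    using assms by (auto simp: disc_curves_def pathstart_compose pathfinish_compose)
  show "hyp_length (translation u \<circ> \<gamma>) = hyp_length \<gamma>"
    unfolding hyp_length_def
  proof (rule integral_cong)
    fix t :: real assume t: "t \<in> {0..1}"
    have "vector_derivative (translation u \<circ> \<gamma>) (at t) = D t * (1 / (?d t)\<^sup>2)"
      by (rule vector_derivative_at[OF D'[OF t]])
    moreover have "vector_derivative \<gamma> (at t) = D t"
      by (rule vector_derivative_at[OF D[OF t]])
    ultimately show "2 * norm (vector_derivative (translation u \<circ> \<gamma>) (at t)) /
        (1 - (norm ((translation u \<circ> \<gamma>) t))\<^sup>2) =
        2 * norm (vector_derivative \<gamma> (at t)) / (1 - (norm (\<gamma> t))\<^sup>2)"
      using d[OF t] one_minus_norm_translation[OF norm_disc_curve_less_1[OF assms t], of u]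
      by (simp add: norm_mult norm_divide norm_power)
  qed
qed

lemma hyp_dist_translation:
  assumes "z \<in> poincare_disc" "w \<in> poincare_disc"
  shows "hyp_dist (translation u z) (translation u w) = hyp_dist z w"
proof -
  have sub: "hyp_length ` disc_curves x y \<subseteq>
      hyp_length ` disc_curves (translation v x) (translation v y)" for v x y
    using translated_curve[of _ x y v] by (metis (no_types, lifting) image_subsetI image_eqI)
  have "translation (-u) (translation u x) = x" if "x \<in> poincare_disc" for x
    using that by (simp add: translation_add)
  then have "hyp_length ` disc_curves (translation u z) (translation u w) =
      hyp_length ` disc_curves z w"
    using sub[of z w u] sub[of "translation u z" "translation u w" "-u"] assms by auto
  then show ?thesis by (simp add: hyp_dist_eq_INF)
qed

text \<open>Neither the density \<open>2 / (1 - \<bar>z\<bar>\<^sup>2)\<close> nor the speed increases when a curve is replaced by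
  its projection to the real diameter, where \<open>2 artanh\<close> is a primitive of the density. The sign \<open>e\<close>
  lets the same argument bound the length by the displacement in either direction.\<close>

lemma hyp_length_lower_bound:
  assumes "\<gamma> \<in> disc_curves z w" "\<bar>e\<bar> = 1"
  shows "2 * (artanh (e * Re w) - artanh (e * Re z)) \<le> hyp_length \<gamma>"
proof -
  from assms obtain D where D: "\<And>t. t \<in> {0..1} \<Longrightarrow> (\<gamma> has_vector_derivative D t) (at t)"
    and cont: "continuous_on {0..1} D"
    unfolding disc_curves_def C1_differentiable_on_def by blast
  have ends: "\<gamma> 0 = z" "\<gamma> 1 = w"
    using assms by (auto simp: disc_curves_def pathstart_def pathfinish_def)
  have contg: "continuous_on {0..1} \<gamma>"
    by (meson D continuous_at_imp_continuous_on has_vector_derivative_continuous)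
  have e2: "e\<^sup>2 = 1" using assms(2) by (metis one_power2 power2_abs)
  have Re_less: "\<bar>e * Re (\<gamma> t)\<bar> < 1" if "t \<in> {0..1}" for t
    using norm_disc_curve_less_1[OF assms(1) that] abs_Re_le_cmod[of "\<gamma> t"] assms(2)
    by (simp add: abs_mult)
  have norm_sq: "(norm (\<gamma> t))\<^sup>2 < 1" if "t \<in> {0..1}" for t
    using norm_disc_curve_less_1[OF assms(1) that] by (simp add: power_less_one_iff)
  define h where "h t = 2 * (e * Re (D t)) / (1 - (e * Re (\<gamma> t))\<^sup>2)" for t
  have "((\<lambda>t. 2 * artanh (e * Re (\<gamma> t))) has_vector_derivative h t) (at t within {0..1})"
    if t: "t \<in> {0..1}" for t
  proof -
    have "((\<lambda>t. Re (\<gamma> t)) has_real_derivative Re (D t)) (at t)"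
      using D[OF t] has_field_derivative_Re by blast
    then have "((\<lambda>t. e * Re (\<gamma> t)) has_real_derivative e * Re (D t)) (at t)"
      by (rule DERIV_cmult)
    then have "((\<lambda>t. artanh (e * Re (\<gamma> t))) has_real_derivative
        1 / (1 - (e * Re (\<gamma> t))\<^sup>2) * (e * Re (D t))) (at t)"
      using DERIV_chain2[of artanh _ "\<lambda>t. e * Re (\<gamma> t)"]
        artanh_real_has_field_derivative[OF Re_less[OF t]] by blast
    then have "((\<lambda>t. 2 * artanh (e * Re (\<gamma> t))) has_real_derivative
        2 * (1 / (1 - (e * Re (\<gamma> t))\<^sup>2) * (e * Re (D t)))) (at t)"
      by (rule DERIV_cmult)
    then have "((\<lambda>t. 2 * artanh (e * Re (\<gamma> t))) has_real_derivative h t) (at t)"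
      by (simp add: h_def)
    then show ?thesis
      unfolding has_real_derivative_iff_has_vector_derivative
      by (rule has_vector_derivative_at_within)
  qed
  then have int_h: "(h has_integral (2 * artanh (e * Re w) - 2 * artanh (e * Re z))) {0..1}"
    using fundamental_theorem_of_calculus[of 0 1 "\<lambda>t. 2 * artanh (e * Re (\<gamma> t))" h]
    by (simp add: ends)
  let ?L = "\<lambda>t. 2 * norm (vector_derivative \<gamma> (at t)) / (1 - (norm (\<gamma> t))\<^sup>2)"
  have L: "?L t = 2 * norm (D t) / (1 - (norm (\<gamma> t))\<^sup>2)" if "t \<in> {0..1}" for t
    using vector_derivative_at[OF D[OF that]] by simp
  have "(\<lambda>t. 2 * norm (D t) / (1 - (norm (\<gamma> t))\<^sup>2)) integrable_on {0..1}"
    using norm_sq by (intro integrable_continuous_real continuous_intros cont contg) force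
  then have int_L: "?L integrable_on {0..1}"
    by (rule integrable_eq) (simp only: L)
  have "h t \<le> ?L t" if t: "t \<in> {0..1}" for t
  proof -
    have "e * Re (D t) \<le> norm (D t)"
      using abs_Re_le_cmod[of "D t"] assms(2) by (auto simp: abs_if split: if_splits)
    moreover have "(e * Re (\<gamma> t))\<^sup>2 \<le> (norm (\<gamma> t))\<^sup>2"
      using e2 by (simp add: power_mult_distrib cmod_power2)
    ultimately show ?thesis
      unfolding h_def L[OF t] using norm_sq[OF t] by (intro frac_le) auto
  qed
  then have "integral {0..1} h \<le> integral {0..1} ?L"
    using int_h int_L by (intro integral_le) auto
  then show ?thesis
    using int_h by (simp add: hyp_length_def integral_unique)
qed

lemma hyp_dist_0_tanh: "2 * \<bar>u\<bar> \<le> hyp_dist 0 (of_real (tanh u))"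
  unfolding hyp_dist_eq_INF
proof (rule cINF_greatest)
  show "disc_curves 0 (of_real (tanh u)) \<noteq> {}"
    using tanh_real_bounds[of u] by (intro disc_curves_nonempty) (auto simp: abs_less_iff)
  fix \<gamma> assume g: "\<gamma> \<in> disc_curves 0 (of_real (tanh u))"
  show "2 * \<bar>u\<bar> \<le> hyp_length \<gamma>"
    using hyp_length_lower_bound[OF g, of 1] hyp_length_lower_bound[OF g, of "-1"]
      artanh_tanh_real[of u] artanh_tanh_real[of "-u"]
    by (auto simp: abs_if)
qed

definition translation_isometry :: "real \<Rightarrow> complex \<Rightarrow> complex"
  where "translation_isometry u = restrict (translation u) poincare_disc"

lemma translation_isometry_in_Bij: "translation_isometry u \<in> Bij poincare_disc"
proof -
  have "bij_betw (translation u) poincare_disc poincare_disc"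
    by (rule bij_betw_byWitness[where f' = "translation (-u)"])
      (auto simp: translation_add norm_translation_less_1)
  then show ?thesis
    unfolding Bij_def translation_isometry_def
    by (simp only: bij_betw_restrict_eq restrict_extensional Int_iff mem_Collect_eq simp_thms)
qed

text \<open>The real derivative is multiplication by a complex number \<open>c \<noteq> 0\<close>, whose determinant is
  \<open>\<bar>c\<bar>\<^sup>2\<close>.\<close>

lemma orientation_preserving_translation_isometry:
  assumes "z \<in> poincare_disc"
  shows "orientation_preserving_at (translation_isometry u) z"
proof -
  define c where "c = 1 / (of_real (sinh u) * z + complex_of_real (cosh u))\<^sup>2"
  have "c \<noteq> 0"
    using translation_denominator_nonzero[of z u] assms by (simp add: c_def)
  then have "0 < Im (cnj (c * 1) * (c * \<i>))"
    by (simp add: complex_eq_iff sum_power2_gt_zero_iff flip: power2_eq_square)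
  moreover have "(translation u has_derivative (*) c) (at z)"
    using translation_field_derivative[of z u] assms
    by (simp add: has_field_derivative_def c_def)
  then have "(translation_isometry u has_derivative (*) c) (at z)"
    by (rule has_derivative_transform_within_open[of _ _ _ _ poincare_disc])
      (use assms in \<open>auto simp: translation_isometry_def\<close>)
  ultimately show ?thesis
    unfolding orientation_preserving_at_def by blast
qed

lemma translation_isometry_in_con_plus: "translation_isometry u \<in> con_plus"
proof -
  have "hyp_dist (translation_isometry u z) (translation_isometry u w) = hyp_dist z w"
    if "z \<in> poincare_disc" "w \<in> poincare_disc" for z w
    using hyp_dist_translation[OF that] that by (simp add: translation_isometry_def)
  then show ?thesis
    unfolding con_plus_def
    using translation_isometry_in_Bij orientation_preserving_translation_isometry by simp
qed

lemma translation_isometry_mult: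
  "translation_isometry u \<otimes>\<^bsub>BijGroup poincare_disc\<^esub> translation_isometry v =
    translation_isometry (u + v)"
proof -
  have "translation_isometry u \<otimes>\<^bsub>BijGroup poincare_disc\<^esub> translation_isometry v =
      compose poincare_disc (translation_isometry u) (translation_isometry v)"
    using translation_isometry_in_Bij[of u] translation_isometry_in_Bij[of v]
    by (simp add: BijGroup_def)
  also have "\<dots> = translation_isometry (u + v)"
  proof
    fix z
    show "compose poincare_disc (translation_isometry u) (translation_isometry v) z =
        translation_isometry (u + v) z"
      by (cases "z \<in> poincare_disc")
        (simp_all add: compose_def translation_isometry_def translation_add norm_translation_less_1)
  qed
  finally show ?thesis .
qed

lemma translation_isometry_0: "translation_isometry 0 = \<one>\<^bsub>BijGroup poincare_disc\<^esub>"
  by (auto simp: BijGroup_def translation_isometry_def)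

lemma translation_isometry_inv:
  "inv\<^bsub>BijGroup poincare_disc\<^esub> (translation_isometry u) = translation_isometry (- u)"
proof (rule group.inv_equality[OF group_BijGroup])
  show "translation_isometry (- u) \<otimes>\<^bsub>BijGroup poincare_disc\<^esub> translation_isometry u =
      \<one>\<^bsub>BijGroup poincare_disc\<^esub>"
    unfolding translation_isometry_mult by (simp add: translation_isometry_0)
qed (use translation_isometry_in_Bij in \<open>auto simp: BijGroup_def\<close>)

lemma translation_isometry_tanh:
  "translation_isometry u (of_real (tanh v)) = of_real (tanh (u + v))"
  using tanh_real_bounds[of v]
  by (simp add: translation_isometry_def translation_tanh abs_less_iff)

lemma translation_isometry_0_apply: "translation_isometry u 0 = of_real (tanh u)"
  using translation_isometry_tanh[of u 0] by simp

section \<open>A cyclic Fuchsian group, its limit set and its exponent\<close>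

definition translation_group :: "(complex \<Rightarrow> complex) set"
  where "translation_group = range (\<lambda>n::int. translation_isometry (of_int n))"

lemma translation_group_subgroup: "subgroup translation_group (BijGroup poincare_disc)"
proof
  show "translation_group \<subseteq> carrier (BijGroup poincare_disc)"
    using translation_isometry_in_Bij by (auto simp: translation_group_def BijGroup_def)
  show "\<one>\<^bsub>BijGroup poincare_disc\<^esub> \<in> translation_group"
    unfolding translation_group_def translation_isometry_0[symmetric]
    by (rule range_eqI[of _ _ 0]) simp
next
  fix g h assume "g \<in> translation_group" "h \<in> translation_group"
  then obtain m n :: int where "g = translation_isometry m" "h = translation_isometry n"
    by (auto simp: translation_group_def)
  then show "g \<otimes>\<^bsub>BijGroup poincare_disc\<^esub> h \<in> translation_group"
    unfolding translation_group_def
    by (intro range_eqI[of _ _ "m + n"]) (simp add: translation_isometry_mult)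
next
  fix g assume "g \<in> translation_group"
  then obtain n :: int where "g = translation_isometry n"
    by (auto simp: translation_group_def)
  then show "inv\<^bsub>BijGroup poincare_disc\<^esub> g \<in> translation_group"
    unfolding translation_group_def
    by (intro range_eqI[of _ _ "- n"]) (simp add: translation_isometry_inv)
qed

text \<open>The translation by \<open>n\<close> is isolated already by the image of the single point \<open>0\<close>: the
  orbit point \<open>tanh n\<close> is the only one with real part strictly between \<open>tanh (n - 1)\<close> and
  \<open>tanh (n + 1)\<close>.\<close>

lemma translation_group_discrete:
  "subtopology con_plus_topology translation_group = discrete_topology translation_group"
proof -
  have basic: "openin con_plus_topology {h \<in> con_plus. h ` K \<subseteq> U}"
    if "compact K" "K \<subseteq> poincare_disc" "open U" for K U
    unfolding con_plus_topology_def using that by (intro topology_generated_by_Basis) blast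
  have "openin (subtopology con_plus_topology translation_group) {g}"
    if mem: "g \<in> translation_group" for g
  proof -
    obtain n :: int where g: "g = translation_isometry (of_int n)"
      using mem unfolding translation_group_def by blast
    define U where "U = {z. tanh (real_of_int n - 1) < Re z} \<inter> {z. Re z < tanh (real_of_int n + 1)}"
    have "open U"
      unfolding U_def by (intro open_Int open_halfspace_Re_gt open_halfspace_Re_lt)
    then have "openin con_plus_topology {h \<in> con_plus. h ` {0} \<subseteq> U}"
      by (intro basic) auto
    moreover have "{h \<in> con_plus. h ` {0} \<subseteq> U} \<inter> translation_group = {g}"
    proof -
      have mem: "translation_isometry (of_int m) 0 \<in> U \<longleftrightarrow> m = n" for m :: int
        unfolding U_def translation_isometry_0_apply by auto
      show ?thesis
        using mem translation_isometry_in_con_plus g by (auto simp: translation_group_def)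
    qed
    ultimately show ?thesis
      unfolding openin_subtopology by metis
  qed
  moreover have "topspace (subtopology con_plus_topology translation_group) \<subseteq> translation_group"
    by simp
  ultimately show ?thesis
    by (metis discrete_topology_unique_alt)
qed

lemma fuchsian_translation_group: "fuchsian_group translation_group"
  unfolding fuchsian_group_def
  using translation_group_subgroup translation_group_discrete translation_isometry_in_con_plus
  by (auto simp: translation_group_def)

lemma group_orbit_tanh:
  "group_orbit translation_group (of_real ` tanh ` X) =
    of_real ` tanh ` {of_int n + x |n x. x \<in> X}"
proof -
  have "translation_isometry (of_int n) ` of_real ` tanh ` X =
      of_real ` tanh ` (\<lambda>x. of_int n + x) ` X" for n
    by (simp add: image_image translation_isometry_tanh)
  then show ?thesis
    unfolding group_orbit_def translation_group_def by auto
qed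

text \<open>All orbit points but the finitely many with \<open>\<bar>n\<bar> \<le> N\<close> lie in the closed set of real numbers
  of modulus between \<open>tanh N\<close> and \<open>1\<close>. A limit point therefore lies in that set for every \<open>N\<close>,
  and \<open>tanh N\<close> tends to \<open>1\<close>.\<close>

lemma limit_set_translation_group: "limit_set translation_group \<subseteq> {1, -1}"
proof
  let ?O = "group_orbit translation_group {0}"
  fix z assume "z \<in> limit_set translation_group"
  then have z: "z \<in> closure ?O" "z \<notin> ?O"
    by (auto simp: limit_set_def)
  have O: "?O = range (\<lambda>n::int. of_real (tanh (of_int n)))"
    unfolding group_orbit_def translation_group_def
    by (auto simp: translation_isometry_0_apply)
  have far: "Im z = 0 \<and> tanh (real N) \<le> \<bar>Re z\<bar> \<and> \<bar>Re z\<bar> \<le> 1" for N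
  proof -
    let ?K = "{z. Im z = 0} \<inter> {z. tanh (real N) \<le> \<bar>Re z\<bar>} \<inter> {z. \<bar>Re z\<bar> \<le> 1}"
    let ?F = "(\<lambda>n::int. complex_of_real (tanh (of_int n))) ` {- int N..int N}"
    have "closure ?O \<subseteq> ?F \<union> ?K"
    proof (rule closure_minimal)
      show "closed (?F \<union> ?K)"
        by (intro closed_Un closed_Int closed_Collect_eq closed_Collect_le continuous_intros
            finite_imp_closed finite_imageI) auto
      have "complex_of_real (tanh (of_int n)) \<in> ?F \<union> ?K" for n :: int
      proof (cases "\<bar>n\<bar> \<le> int N")
        case True
        then have "n \<in> {- int N..int N}" by auto
        then show ?thesis by blast
      next
        case False
        then have "real N \<le> \<bar>of_int n\<bar>"
          by linarith
        then have "tanh (real N) \<le> \<bar>tanh (of_int n)\<bar>"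
          by (simp only: tanh_real_abs[symmetric] tanh_real_le_iff)
        moreover have "\<bar>tanh (real_of_int n)\<bar> \<le> 1"
          using tanh_real_bounds[of "real_of_int n"] by (simp add: abs_le_iff)
        ultimately show ?thesis by simp
      qed
      then show "?O \<subseteq> ?F \<union> ?K"
        unfolding O by blast
    qed
    moreover have "?F \<subseteq> ?O" unfolding O by blast
    ultimately show ?thesis using z by blast
  qed
  have "(\<lambda>N. tanh (real N)) \<longlonglongrightarrow> 1"
    by (rule filterlim_compose[OF tanh_real_at_top filterlim_real_sequentially])
  then have "1 \<le> \<bar>Re z\<bar>"
    by (rule LIMSEQ_le_const2) (use far in blast)
  then have "\<bar>Re z\<bar> = 1" "Im z = 0"
    using far[of 0] by auto
  then show "z \<in> {1, -1}"
    by (auto simp: complex_eq_iff abs_if split: if_splits)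
qed

lemma elementary_translation_group: "elementary translation_group"
proof
  assume "non_elementary translation_group"
  then obtain A where A: "A \<subseteq> limit_set translation_group" "card A = 3"
    by (auto simp: non_elementary_def)
  have "card A \<le> card {1, -1 :: complex}"
    using A limit_set_translation_group by (intro card_mono) auto
  then show False using A by simp
qed

lemma summable_on_geometric_abs_int:
  fixes s :: real
  assumes "s > 0"
  shows "(\<lambda>n::int. exp (- s * (2 * \<bar>of_int n\<bar>))) summable_on UNIV"
proof -
  let ?f = "\<lambda>n::int. exp (- s * (2 * \<bar>real_of_int n\<bar>))"
  have "summable (\<lambda>n::nat. exp (- (2 * s)) ^ n)"
    using assms by (intro summable_geometric) auto
  then have geo: "(\<lambda>n::nat. exp (- (2 * s)) ^ n) summable_on UNIV"
    by (intro norm_summable_imp_summable_on) simp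
  have pow: "?f (int n) = exp (- (2 * s)) ^ n" "?f (- int n) = exp (- (2 * s)) ^ n" for n
  proof -
    have "- s * (2 * \<bar>of_int (int n)\<bar>) = of_nat n * (- (2 * s))"
      "- s * (2 * \<bar>of_int (- int n)\<bar>) = of_nat n * (- (2 * s))"
      by simp_all
    then show "?f (int n) = exp (- (2 * s)) ^ n" "?f (- int n) = exp (- (2 * s)) ^ n"
      by (simp_all only: exp_of_nat_mult)
  qed
  have 1: "?f summable_on range int"
    unfolding summable_on_reindex[OF inj_of_nat] o_def pow by (rule geo)
  have inj: "inj (\<lambda>n. - int n)" by (auto simp: inj_def)
  have 2: "?f summable_on range (\<lambda>n. - int n)"
    unfolding summable_on_reindex[OF inj] o_def pow by (rule geo)
  have "UNIV = range int \<union> range (\<lambda>n. - int n)"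
    by (auto intro: int_cases2)
  then show ?thesis
    using summable_on_union[OF 1 2] by simp
qed

text \<open>Comparison with the geometric series, by \<open>hyp_dist_0_tanh\<close>.\<close>

lemma poincare_series_translation_group:
  assumes "s > 0"
  shows "poincare_series translation_group s < \<infinity>"
proof -
  let ?f = "\<lambda>n::int. exp (- s * (2 * \<bar>real_of_int n\<bar>))"
  have "poincare_series translation_group s \<le> ennreal (infsum ?f UNIV)"
    unfolding poincare_series_def
  proof (rule infsum_le_finite_sums)
    show "(\<lambda>g. ennreal (exp (- s * hyp_dist 0 (g 0)))) summable_on translation_group"
      by (simp add: nonneg_summable_on_complete)
  next
    fix F assume F: "finite F" "F \<subseteq> translation_group"
    then obtain N where N: "inj_on (\<lambda>n::int. translation_isometry (of_int n)) N"
      "F = (\<lambda>n. translation_isometry (of_int n)) ` N"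
      unfolding translation_group_def subset_image_inj by blast
    have fin: "finite N"
      using F(1) unfolding N(2) by (rule finite_imageD[OF _ N(1)])
    have "(\<Sum>g\<in>F. ennreal (exp (- s * hyp_dist 0 (g 0)))) =
        (\<Sum>n\<in>N. ennreal (exp (- s * hyp_dist 0 (of_real (tanh (of_int n))))))"
      unfolding N(2) by (simp add: sum.reindex[OF N(1)] translation_isometry_0_apply)
    also have "\<dots> \<le> (\<Sum>n\<in>N. ennreal (?f n))"
      using assms by (intro sum_mono ennreal_leI) (simp add: hyp_dist_0_tanh)
    also have "\<dots> = ennreal (\<Sum>n\<in>N. ?f n)"
      by (rule sum_ennreal) simp
    also have "\<dots> \<le> ennreal (infsum ?f UNIV)"
      by (intro ennreal_leI finite_sum_le_infsum summable_on_geometric_abs_int assms fin) auto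
    finally show "(\<Sum>g\<in>F. ennreal (exp (- s * hyp_dist 0 (g 0)))) \<le> ennreal (infsum ?f UNIV)" .
  qed
  then show ?thesis
    unfolding infinity_ennreal_def by (rule le_less_trans) simp
qed

lemma poincare_exponent_translation_group: "poincare_exponent translation_group = 0"
proof (rule antisym)
  show "poincare_exponent translation_group \<le> 0"
  proof (rule ereal_le_epsilon2)
    fix e :: real assume "0 < e"
    then show "poincare_exponent translation_group \<le> 0 + ereal e"
      unfolding poincare_exponent_def
      using poincare_series_translation_group by (auto intro!: INF_lower)
  qed
  show "0 \<le> poincare_exponent translation_group"
    unfolding poincare_exponent_def by (auto intro!: INF_greatest)
qed

section \<open>Covering numbers and box dimensions\<close>

lemma covering_number_le:
  assumes "finite \<U>" "card \<U> \<le> n" "\<And>U. U \<in> \<U> \<Longrightarrow> bounded U \<and> diameter U \<le> \<rho>" "E \<subseteq> \<Union>\<U>"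
  shows "covering_number \<rho> E \<le> n"
  unfolding covering_number_def
  by (rule order_trans[OF Least_le assms(2)]) (use assms in blast)

lemma covering_number_attained:
  assumes "finite \<U>" "\<And>U. U \<in> \<U> \<Longrightarrow> bounded U \<and> diameter U \<le> \<rho>" "E \<subseteq> \<Union>\<U>"
  obtains \<V> where "finite \<V>" "card \<V> = covering_number \<rho> E"
    "\<And>U. U \<in> \<V> \<Longrightarrow> bounded U \<and> diameter U \<le> \<rho>" "E \<subseteq> \<Union>\<V>"
proof -
  have "\<exists>\<V>. finite \<V> \<and> card \<V> = covering_number \<rho> E \<and>
      (\<forall>U\<in>\<V>. bounded U \<and> diameter U \<le> \<rho>) \<and> E \<subseteq> \<Union>\<V>"
    unfolding covering_number_def by (rule LeastI_ex) (use assms in blast)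
  then show ?thesis using that by blast
qed

text \<open>A bound \<open>h\<close> on the covering numbers that grows more slowly than every power of \<open>1/\<rho>\<close> makes
  the dimension vanish. As \<open>ln 0 = 0\<close>, the quotients are nonnegative even when the covering
  number is \<open>0\<close>; for the same reason \<open>h\<close> has to be at least \<open>1\<close>.\<close>

lemma upper_box_dim_eq_0:
  assumes "eventually (\<lambda>\<rho>. real (covering_number \<rho> E) \<le> h \<rho>) (at_right 0)"
    and "((\<lambda>\<rho>. ln (h \<rho>) / - ln \<rho>) \<longlongrightarrow> 0) (at_right 0)"
    and "eventually (\<lambda>\<rho>. 1 \<le> h \<rho>) (at_right 0)"
  shows "upper_box_dim E = 0"
proof -
  let ?q = "\<lambda>\<rho>. ln (real (covering_number \<rho> E)) / - ln \<rho>"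
  have small: "eventually (\<lambda>\<rho>::real. 0 < \<rho> \<and> \<rho> < 1) (at_right 0)"
    by (auto simp: eventually_at_right_field intro!: exI[of _ 1])
  have lower: "eventually (\<lambda>\<rho>. 0 \<le> ?q \<rho>) (at_right 0)"
    using small
  proof eventually_elim
    case (elim \<rho>)
    have "0 \<le> ln (real (covering_number \<rho> E))"
      by (cases "covering_number \<rho> E = 0") auto
    then show ?case using elim by (simp add: divide_nonneg_neg)
  qed
  have upper: "eventually (\<lambda>\<rho>. ?q \<rho> \<le> ln (h \<rho>) / - ln \<rho>) (at_right 0)"
    using small assms(1,3)
  proof eventually_elim
    case (elim \<rho>)
    have "ln (real (covering_number \<rho> E)) \<le> ln (h \<rho>)"
      using elim by (cases "covering_number \<rho> E = 0") auto
    then show ?case using elim by (intro divide_right_mono) auto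
  qed
  have "(?q \<longlongrightarrow> 0) (at_right 0)"
    by (rule tendsto_sandwich[OF lower upper tendsto_const assms(2)])
  then show ?thesis
    unfolding upper_box_dim_def zero_ereal_def
    by (intro lim_imp_Limsup) (auto intro: tendsto_intros)
qed

lemma upper_box_dim_finite:
  assumes "finite E"
  shows "upper_box_dim E = 0"
proof (rule upper_box_dim_eq_0)
  \<comment> \<open>The summand \<open>1\<close> keeps the bound at least \<open>1\<close> when \<open>E\<close> is empty.\<close>
  show "eventually (\<lambda>\<rho>. real (covering_number \<rho> E) \<le> real (card E + 1)) (at_right 0)"
  proof (rule eventually_at_right_less[THEN eventually_mono])
    fix \<rho> :: real assume "0 < \<rho>"
    then have "covering_number \<rho> E \<le> card E"
      using assms by (intro covering_number_le[of "(\<lambda>x. {x}) ` E"]) (auto intro: card_image_le)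
    then show "real (covering_number \<rho> E) \<le> real (card E + 1)" by simp
  qed
  show "((\<lambda>\<rho>. ln (real (card E + 1)) / - ln \<rho>) \<longlongrightarrow> 0) (at_right 0)"
    by real_asymp
qed simp

lemma diameter_of_real_interval:
  fixes a b :: real
  assumes "a \<le> b"
  shows "bounded (complex_of_real ` {a..b})" "diameter (complex_of_real ` {a..b}) \<le> b - a"
proof -
  show "bounded (complex_of_real ` {a..b})"
    by (intro compact_imp_bounded compact_continuous_image continuous_intros) auto
  show "diameter (complex_of_real ` {a..b}) \<le> b - a"
    by (rule diameter_le) (use assms in \<open>auto simp flip: of_real_diff\<close>)
qed

lemma covering_number_interval:
  assumes "0 < \<rho>" "E \<subseteq> complex_of_real ` {-1..1}"
  shows "real (covering_number \<rho> E) \<le> 2 / \<rho> + 1"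
    and "\<exists>\<U>. finite \<U> \<and> (\<forall>U\<in>\<U>. bounded U \<and> diameter U \<le> \<rho>) \<and> E \<subseteq> \<Union>\<U>"
proof -
  \<comment> \<open>Rounding down and adding one, rather than rounding up, makes the intervals reach beyond
    \<open>1\<close>, so that the end point needs no separate treatment.\<close>
  define n where "n = nat \<lfloor>2 / \<rho>\<rfloor> + 1"
  define \<U> where "\<U> = (\<lambda>i. complex_of_real ` {-1 + real i * \<rho>..-1 + real (Suc i) * \<rho>}) ` {..<n}"
  have U: "finite \<U>" "card \<U> \<le> n" "\<And>U. U \<in> \<U> \<Longrightarrow> bounded U \<and> diameter U \<le> \<rho>"
  proof -
    show "finite \<U>" "card \<U> \<le> n"
      unfolding \<U>_def using card_image_le[of "{..<n}"] by auto
    fix U assume "U \<in> \<U>"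
    then obtain i where i: "U = complex_of_real ` {-1 + real i * \<rho>..-1 + real (Suc i) * \<rho>}"
      by (auto simp: \<U>_def)
    have "real (Suc i) * \<rho> = real i * \<rho> + \<rho>"
      by (simp add: algebra_simps)
    then show "bounded U \<and> diameter U \<le> \<rho>"
      using diameter_of_real_interval[of "-1 + real i * \<rho>" "-1 + real (Suc i) * \<rho>"] assms(1)
      unfolding i by simp
  qed
  have cover: "E \<subseteq> \<Union>\<U>"
  proof
    fix z assume "z \<in> E"
    then obtain x where x: "z = of_real x" "-1 \<le> x" "x \<le> 1"
      using assms(2) by auto
    define i where "i = nat \<lfloor>(x + 1) / \<rho>\<rfloor>"
    have "0 \<le> (x + 1) / \<rho>" "(x + 1) / \<rho> \<le> 2 / \<rho>"
      using x assms(1) by (auto intro!: divide_right_mono)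
    then have "i < n" "real i \<le> (x + 1) / \<rho>" "(x + 1) / \<rho> \<le> real (Suc i)"
      unfolding i_def n_def by linarith+
    then have "i < n" "-1 + real i * \<rho> \<le> x" "x \<le> -1 + real (Suc i) * \<rho>"
      using assms(1) by (simp_all add: field_simps)
    then show "z \<in> \<Union>\<U>"
      unfolding \<U>_def x(1) by (intro UN_I[of i]) auto
  qed
  have "covering_number \<rho> E \<le> n"
    using U cover by (rule covering_number_le)
  also have "real n \<le> 2 / \<rho> + 1"
  proof -
    have "0 \<le> 2 / \<rho>" using assms(1) by simp
    then show ?thesis unfolding n_def by linarith
  qed
  finally show "real (covering_number \<rho> E) \<le> 2 / \<rho> + 1" by simp
  show "\<exists>\<U>. finite \<U> \<and> (\<forall>U\<in>\<U>. bounded U \<and> diameter U \<le> \<rho>) \<and> E \<subseteq> \<Union>\<U>"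
    using U cover by blast
qed


text \<open>A set of diameter at most \<open>\<rho>\<close> lies over a closed interval of length \<open>2 \<rho>\<close> around the real
  part of any of its points. Finitely many closed intervals that cover \<open>X\<close> cover its closure, and
  Lebesgue measure bounds their number from below.\<close>

lemma covering_number_ge:
  fixes X :: "real set"
  assumes "0 < \<rho>" "0 \<le> c" "X \<subseteq> {-1..1}" "{0..c} \<subseteq> closure X"
  shows "c / (2 * \<rho>) \<le> real (covering_number \<rho> (of_real ` X))"
proof -
  let ?E = "complex_of_real ` X"
  obtain \<U> where U: "finite \<U>" "card \<U> = covering_number \<rho> ?E"
    "\<And>U. U \<in> \<U> \<Longrightarrow> bounded U \<and> diameter U \<le> \<rho>" "?E \<subseteq> \<Union>\<U>"
    using covering_number_attained covering_number_interval(2)[OF assms(1), of ?E] assms(3)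
    by (metis image_mono)
  define p where "p U = Re (SOME z. z \<in> U)" for U :: "complex set"
  have "X \<subseteq> (\<Union>U\<in>\<U>. {p U - \<rho>..p U + \<rho>})"
  proof
    fix x assume "x \<in> X"
    then obtain V where V: "V \<in> \<U>" "of_real x \<in> V"
      using U(4) by blast
    have "dist (SOME z. z \<in> V) (complex_of_real x) \<le> diameter V"
      using V U(3) by (intro diameter_bounded_bound) (auto intro: someI)
    then have "norm ((SOME z. z \<in> V) - complex_of_real x) \<le> \<rho>"
      using U(3)[OF V(1)] by (simp add: dist_norm)
    then have "\<bar>p V - x\<bar> \<le> \<rho>"
      using abs_Re_le_cmod[of "(SOME z. z \<in> V) - complex_of_real x"] by (simp add: p_def)
    then show "x \<in> (\<Union>U\<in>\<U>. {p U - \<rho>..p U + \<rho>})"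
      using V(1) by (intro UN_I[of V]) auto
  qed
  then have "closure X \<subseteq> (\<Union>U\<in>\<U>. {p U - \<rho>..p U + \<rho>})"
    using U(1) by (intro closure_minimal closed_UN) auto
  then have "{0..c} \<subseteq> (\<Union>U\<in>\<U>. {p U - \<rho>..p U + \<rho>})"
    using assms(4) by blast
  then have "emeasure lborel {0..c} \<le> emeasure lborel (\<Union>U\<in>\<U>. {p U - \<rho>..p U + \<rho>})"
    using U(1) by (intro emeasure_mono sets.finite_UN) auto
  also have "\<dots> \<le> (\<Sum>U\<in>\<U>. emeasure lborel {p U - \<rho>..p U + \<rho>})"
    using U(1) by (intro emeasure_subadditive_finite) auto
  also have "\<dots> = (\<Sum>U\<in>\<U>. ennreal (2 * \<rho>))"
    using assms(1) by (intro sum.cong) auto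
  also have "\<dots> = ennreal (real (card \<U>) * (2 * \<rho>))"
    using assms(1) by (simp add: ennreal_mult ennreal_of_nat_eq_real_of_nat)
  finally have "c \<le> real (card \<U>) * (2 * \<rho>)"
    using assms(1,2) by simp
  then show ?thesis
    using assms(1) U(2) by (simp add: field_simps)
qed

lemma box_dim_dense_in_interval:
  fixes X :: "real set"
  assumes "0 < c" "X \<subseteq> {-1..1}" "{0..c} \<subseteq> closure X"
  shows "lower_box_dim (of_real ` X) = 1" "upper_box_dim (of_real ` X) = 1"
proof -
  let ?N = "\<lambda>\<rho>. real (covering_number \<rho> (of_real ` X))"
  let ?q = "\<lambda>\<rho>. ln (?N \<rho>) / - ln \<rho>"
  have small: "eventually (\<lambda>\<rho>::real. 0 < \<rho> \<and> \<rho> < 1) (at_right 0)"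
    by (auto simp: eventually_at_right_field intro!: exI[of _ 1])
  have "eventually (\<lambda>\<rho>. ln (c / (2 * \<rho>)) / - ln \<rho> \<le> ?q \<rho>) (at_right 0)"
    using small
  proof eventually_elim
    case (elim \<rho>)
    have N: "c / (2 * \<rho>) \<le> ?N \<rho>"
      using elim assms by (intro covering_number_ge) auto
    moreover have pos: "0 < c / (2 * \<rho>)"
      using elim assms by simp
    ultimately have "ln (c / (2 * \<rho>)) \<le> ln (?N \<rho>)"
      by simp
    then show ?case using elim by (intro divide_right_mono) auto
  qed
  moreover have "eventually (\<lambda>\<rho>. ?q \<rho> \<le> ln (2 / \<rho> + 1) / - ln \<rho>) (at_right 0)"
    using small
  proof eventually_elim
    case (elim \<rho>)
    have N: "?N \<rho> \<le> 2 / \<rho> + 1"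
      using elim assms by (intro covering_number_interval(1) image_mono) auto
    have "c / (2 * \<rho>) \<le> ?N \<rho>"
      using elim assms by (intro covering_number_ge) auto
    moreover have pos: "0 < c / (2 * \<rho>)"
      using elim assms by simp
    ultimately have "0 < ?N \<rho>" by linarith
    with N have "ln (?N \<rho>) \<le> ln (2 / \<rho> + 1)" by simp
    then show ?case using elim by (intro divide_right_mono) auto
  qed
  ultimately have "(?q \<longlongrightarrow> 1) (at_right 0)"
  proof (rule tendsto_sandwich)
    show "((\<lambda>\<rho>. ln (c / (2 * \<rho>)) / - ln \<rho>) \<longlongrightarrow> 1) (at_right 0)"
      using assms(1) by real_asymp
    show "((\<lambda>\<rho>::real. ln (2 / \<rho> + 1) / - ln \<rho>) \<longlongrightarrow> 1) (at_right 0)"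
      by real_asymp
  qed
  then have lim: "((\<lambda>\<rho>. ereal (?q \<rho>)) \<longlongrightarrow> 1) (at_right 0)"
    unfolding one_ereal_def by (intro tendsto_intros)
  show "lower_box_dim (of_real ` X) = 1"
    unfolding lower_box_dim_def by (rule lim_imp_Liminf[OF _ lim]) simp
  show "upper_box_dim (of_real ` X) = 1"
    unfolding upper_box_dim_def by (rule lim_imp_Limsup[OF _ lim]) simp
qed

text \<open>At scale \<open>\<rho>\<close>, one interval of length \<open>\<rho>\<close> with end point \<open>1\<close> contains every \<open>x k\<close> with
  \<open>2 exp (- 2 k) \<le> \<rho>\<close>; the remaining \<open>O(ln (1/\<rho>))\<close> points are covered by singletons.\<close>

lemma upper_box_dim_exponential_sequence:
  fixes x :: "nat \<Rightarrow> real"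
  assumes "\<And>k. 1 - 2 * exp (- (2 * real k)) \<le> x k" "\<And>k. x k \<le> 1"
  shows "upper_box_dim (range (\<lambda>k. complex_of_real (x k))) = 0"
proof (rule upper_box_dim_eq_0)
  let ?E = "range (\<lambda>k. complex_of_real (x k))"
  have small: "eventually (\<lambda>\<rho>::real. 0 < \<rho> \<and> \<rho> < 1) (at_right 0)"
    by (auto simp: eventually_at_right_field intro!: exI[of _ 1])
  show "eventually (\<lambda>\<rho>. real (covering_number \<rho> ?E) \<le> ln (2 / \<rho>) / 2 + 2) (at_right 0)"
    using small
  proof eventually_elim
    case (elim \<rho>)
    define K where "K = nat \<lceil>ln (2 / \<rho>) / 2\<rceil>"
    have ln_pos: "0 \<le> ln (2 / \<rho>)" using elim by simp
    have "ln (2 / \<rho>) \<le> 2 * real K"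
      unfolding K_def by linarith
    then have "2 / \<rho> \<le> exp (2 * real K)"
      using elim ln_le_cancel_iff[of "2 / \<rho>" "exp (2 * real K)"] by simp
    then have K: "2 * exp (- (2 * real K)) \<le> \<rho>"
      using elim by (simp add: exp_minus divide_simps mult.commute)
    let ?tail = "complex_of_real ` {1 - \<rho>..1}"
    let ?\<U> = "insert ?tail ((\<lambda>k. {complex_of_real (x k)}) ` {..<K})"
    have "covering_number \<rho> ?E \<le> Suc K"
    proof (rule covering_number_le)
      show "finite ?\<U>" by simp
      show "card ?\<U> \<le> Suc K"
        by (rule order_trans[OF card_insert_le_m1])
          (auto intro: order_trans[OF card_image_le])
      show "bounded U \<and> diameter U \<le> \<rho>" if "U \<in> ?\<U>" for U
        using that diameter_of_real_interval[of "1 - \<rho>" 1] elim by auto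
      show "?E \<subseteq> \<Union>?\<U>"
      proof
        fix z assume "z \<in> ?E"
        then obtain k where k: "z = of_real (x k)" by auto
        show "z \<in> \<Union>?\<U>"
        proof (cases "k < K")
          case True
          then show ?thesis using k by auto
        next
          case False
          then have "exp (- (2 * real k)) \<le> exp (- (2 * real K))" by simp
          then have "1 - \<rho> \<le> x k"
            using assms(1)[of k] K by linarith
          then show ?thesis using assms(2)[of k] k by auto
        qed
      qed
    qed
    moreover have "real (Suc K) \<le> ln (2 / \<rho>) / 2 + 2"
      using ln_pos unfolding K_def by linarith
    ultimately show ?case by linarith
  qed
  show "eventually (\<lambda>\<rho>::real. 1 \<le> ln (2 / \<rho>) / 2 + 2) (at_right 0)"
    by real_asymp
  show "((\<lambda>\<rho>::real. ln (ln (2 / \<rho>) / 2 + 2) / - ln \<rho>) \<longlongrightarrow> 0) (at_right 0)"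
    by real_asymp
qed

section \<open>The escaping sequence\<close>

lemma closure_tanh_Rats: "{0..tanh 1} \<subseteq> closure (tanh ` (\<rat> :: real set))"
proof
  fix y :: real assume "y \<in> {0..tanh 1}"
  moreover have "continuous_on {0..1} (\<lambda>x::real. tanh x)"
    by (intro continuous_intros) auto
  ultimately obtain x :: real where x: "y = tanh x"
    using IVT'[of tanh 0 y 1] by auto
  have "tanh ` closure \<rat> \<subseteq> closure (tanh ` (\<rat> :: real set))"
    by (intro image_closure_subset closure_subset closed_closure continuous_intros) auto
  then show "y \<in> closure (tanh ` \<rat>)"
    unfolding x Rats_closure_real by blast
qed

lemma one_minus_tanh_le: "1 - 2 * exp (- (2 * x)) \<le> tanh (x :: real)"
proof -
  have "tanh x = 1 - 2 * exp (- (2 * x)) / (1 + exp (- (2 * x)))"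
    unfolding tanh_real_altdef by (simp add: field_simps add_pos_pos add_nonneg_eq_0_iff)
  moreover have "2 * exp (- (2 * x)) / (1 + exp (- (2 * x))) \<le> 2 * exp (- (2 * x))"
    by (simp add: field_simps add_pos_pos)
  ultimately show ?thesis by linarith
qed

text \<open>The fractional parts of all rationals are dense in a fundamental interval for the action on
  the diameter. Moving the \<open>k\<close>-th of them by \<open>k\<close> does not change its orbit and makes the
  sequence escape to infinity.\<close>

definition escaping_point :: "nat \<Rightarrow> real"
  where "escaping_point k = real k + frac (of_rat (nat_to_rat_surj k))"

lemma translates_escaping_points:
  "{of_int n + x |n x. x \<in> range escaping_point} = \<rat>"
proof (intro equalityI subsetI)
  fix x assume "x \<in> {of_int n + x |n x. x \<in> range escaping_point}"
  then show "x \<in> \<rat>"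
    by (auto simp: escaping_point_def frac_def)
next
  fix x :: real assume "x \<in> \<rat>"
  then obtain q where q: "x = of_rat q" by (auto elim: Rats_cases)
  obtain k where k: "q = nat_to_rat_surj k"
    using surj_nat_to_rat_surj by (metis surjD)
  have "x = of_int (\<lfloor>x\<rfloor> - int k) + escaping_point k"
    unfolding escaping_point_def k[symmetric] q[symmetric] by (simp add: frac_def)
  then show "x \<in> {of_int n + x |n x. x \<in> range escaping_point}"
    by blast
qed

theorem theorem2p2:
  "\<exists>(C :: complex set) (\<Gamma> :: (complex \<Rightarrow> complex) set).
     C \<noteq> {} \<and> C \<subseteq> poincare_disc \<and> fuchsian_group \<Gamma> \<and> elementary \<Gamma> \<and>
     upper_box_dim (limit_set \<Gamma>) = 0 \<and> upper_box_dim C = 0 \<and> poincare_exponent \<Gamma> = 0 \<and>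
     lower_box_dim (group_orbit \<Gamma> C) = 1 \<and> upper_box_dim (group_orbit \<Gamma> C) = 1"
proof (intro exI conjI)
  let ?C = "complex_of_real ` tanh ` range escaping_point"
  have tanh: "tanh x \<in> {-1..1}" for x :: real
    using tanh_real_bounds[of x] by simp
  show "?C \<noteq> {}" by simp
  show "?C \<subseteq> poincare_disc"
    using tanh_real_bounds by (auto simp: abs_less_iff)
  show "fuchsian_group translation_group" "elementary translation_group"
    "poincare_exponent translation_group = 0"
    by (fact fuchsian_translation_group elementary_translation_group
        poincare_exponent_translation_group)+
  show "upper_box_dim (limit_set translation_group) = 0"
    by (rule upper_box_dim_finite[OF finite_subset[OF limit_set_translation_group]]) simp
  have "upper_box_dim (range (\<lambda>k. complex_of_real (tanh (escaping_point k)))) = 0"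
  proof (rule upper_box_dim_exponential_sequence)
    fix k
    have "real k \<le> escaping_point k"
      by (simp add: escaping_point_def)
    then have "tanh (real k) \<le> tanh (escaping_point k)" by simp
    then show "1 - 2 * exp (- (2 * real k)) \<le> tanh (escaping_point k)"
      using one_minus_tanh_le[of "real k"] by linarith
    show "tanh (escaping_point k) \<le> 1" using tanh by simp
  qed
  then show "upper_box_dim ?C = 0"
    by (simp add: image_image)
  have "{0..tanh 1} \<subseteq> closure (tanh ` \<rat> :: real set)" "tanh ` \<rat> \<subseteq> {-1..1::real}"
    using closure_tanh_Rats tanh by blast+
  then show "lower_box_dim (group_orbit translation_group ?C) = 1"
    "upper_box_dim (group_orbit translation_group ?C) = 1"
    unfolding group_orbit_tanh translates_escaping_points
    by (intro box_dim_dense_in_interval[of "tanh 1"]; simp)+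
qed

end
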